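(* Let $v=ab$ with $a,b\in\mathbb{N}$. For any integers $k_1,k_2$ with $1\le k_1\le b-1$ and $1\le k_2\le a-1$, there exists a non-disjoint $(v,2,k_1a,k_2b)$-GPSEDF in $\mathbb{Z}_v$.
   Context: For subsets $A,B$ of an additively written group $G$, $\Delta(A,B)$ denotes the multiset $\{a-b:a\in A,b\in B\}$ (one entry per pair). For $\lambda\in\mathbb{N}\cup\{0\}$, $\lambda G$ is the multiset containing every element of $G$ exactly $\lambda$ times. Let $|G|=v$. A family of sets $\{A_1,\dots,A_m\}$ in $G$ with $|A_i|=k_i$ is a non-disjoint $(v,m,k_1,\dots,k_m)$-GPSEDF if $\Delta(A_i,A_j)=\lambda_{i,j}G$ with $\lambda_{i,j}=k_ik_j/v$ for all $1\le i\ne j\le m$. *)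

theory Defs
  imports Complex_Main "HOL-Algebra.Elementary_Groups" "HOL-Library.Multiset"
begin

text \<open>
  Groups are HOL-Algebra groups, whose notation is multiplicative: the difference of \<open>x\<close>
  and \<open>y\<close> in the additively written group is \<open>x \<otimes> inv y\<close>.
\<close>

definition diff_mset :: "('a, 'c) monoid_scheme \<Rightarrow> 'a set \<Rightarrow> 'a set \<Rightarrow> 'a multiset" where
  "diff_mset G A B = image_mset (\<lambda>(x, y). x \<otimes>\<^bsub>G\<^esub> inv\<^bsub>G\<^esub> y) (mset_set (A \<times> B))"

definition group_mset :: "nat \<Rightarrow> ('a, 'c) monoid_scheme \<Rightarrow> 'a multiset" where
  "group_mset l G = repeat_mset l (mset_set (carrier G))"

text \<open>
  The family is indexed, so it is given by a list of sets, with \<open>As ! i\<close> of size \<open>ks ! i\<close>;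
  indices start at 0. ``Non-disjoint'' means that disjointness of the sets is not required.
  The quotient \<open>k\<^sub>i k\<^sub>j / v\<close> is the exact one, so \<open>v\<close> has to divide \<open>k\<^sub>i k\<^sub>j\<close>.
\<close>

definition nondisjoint_GPSEDF ::
  "('a, 'c) monoid_scheme \<Rightarrow> nat \<Rightarrow> nat \<Rightarrow> nat list \<Rightarrow> 'a set list \<Rightarrow> bool" where
  "nondisjoint_GPSEDF G v m ks As \<longleftrightarrow>
     group G \<and> finite (carrier G) \<and> order G = v \<and>
     length ks = m \<and> length As = m \<and>
     (\<forall>i<m. As ! i \<subseteq> carrier G \<and> card (As ! i) = ks ! i) \<and>
     (\<forall>i<m. \<forall>j<m. i \<noteq> j \<longrightarrow>
        (\<exists>l::nat. real l = real (ks ! i) * real (ks ! j) / real v \<and>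
                  diff_mset G (As ! i) (As ! j) = group_mset l G))"

end

theory Submission
  imports Defs
begin

text \<open>
  Let \<open>A\<^sub>1\<close> consist of the elements whose residue modulo \<open>b\<close> is less than \<open>k\<^sub>1\<close>, a union of \<open>k\<^sub>1\<close>
  cosets of the subgroup of order \<open>a\<close>, and let \<open>A\<^sub>2 = {0, \<dots>, k\<^sub>2 b - 1}\<close>, which meets every residue
  class modulo \<open>b\<close> exactly \<open>k\<^sub>2\<close> times. Every translate of \<open>A\<^sub>2\<close> has the latter property, hence meets
  \<open>A\<^sub>1\<close> in exactly \<open>k\<^sub>1 k\<^sub>2\<close> elements.
\<close>

lemma count_diff_mset:
  assumes "finite A" "finite B"
  shows "count (diff_mset G A B) d = card {(x, y). x \<in> A \<and> y \<in> B \<and> x \<otimes>\<^bsub>G\<^esub> inv\<^bsub>G\<^esub> y = d}"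
proof -
  have "count (diff_mset G A B) d
      = card {p \<in> A \<times> B. (case p of (x, y) \<Rightarrow> x \<otimes>\<^bsub>G\<^esub> inv\<^bsub>G\<^esub> y) = d}"
    using assms unfolding diff_mset_def
    by (simp add: count_image_mset' count_mset_set' sum.If_cases Int_def conj_commute eq_commute)
  also have "{p \<in> A \<times> B. (case p of (x, y) \<Rightarrow> x \<otimes>\<^bsub>G\<^esub> inv\<^bsub>G\<^esub> y) = d}
      = {(x, y). x \<in> A \<and> y \<in> B \<and> x \<otimes>\<^bsub>G\<^esub> inv\<^bsub>G\<^esub> y = d}"
    by auto
  finally show ?thesis .
qed

context group
begin

text \<open>For fixed \<open>d\<close> a pair is determined by its second entry, since
  \<open>x = d \<otimes> y\<close>. The multiplicity of \<open>d\<close> thus becomes the size of an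
  intersection with a translate.\<close>

lemma count_diff_mset_right:
  assumes "finite A" "finite B" "A \<subseteq> carrier G" "B \<subseteq> carrier G" "d \<in> carrier G"
  shows "count (diff_mset G A B) d = card {y \<in> B. d \<otimes> y \<in> A}"
proof -
  have "x \<otimes> inv y = d \<longleftrightarrow> x = d \<otimes> y" if "x \<in> A" "y \<in> B" for x y
    using that assms inv_solve_right'[of d x y] by (metis subsetD)
  then have "{(x, y). x \<in> A \<and> y \<in> B \<and> x \<otimes> inv y = d}
      = {(x, y). x \<in> A \<and> y \<in> B \<and> x = d \<otimes> y}"
    by blast
  also have "\<dots> = (\<lambda>y. (d \<otimes> y, y)) ` {y \<in> B. d \<otimes> y \<in> A}"
    by auto
  finally show ?thesis
    unfolding count_diff_mset[OF assms(1,2)] by (simp add: card_image inj_on_def)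
qed

text \<open>Here the first entry determines the pair. For the differences in the opposite order this
  leaves the translated set the same, with \<open>inv d\<close> in place of
  \<open>d\<close>.\<close>

lemma count_diff_mset_left:
  assumes "finite A" "finite B" "A \<subseteq> carrier G" "B \<subseteq> carrier G" "d \<in> carrier G"
  shows "count (diff_mset G A B) d = card {x \<in> A. inv d \<otimes> x \<in> B}"
proof -
  have "x \<otimes> inv y = d \<longleftrightarrow> y = inv d \<otimes> x" if "x \<in> A" "y \<in> B" for x y
    using that assms inv_solve_right'[of d x y] inv_solve_left[of y d x] by (metis subsetD)
  then have "{(x, y). x \<in> A \<and> y \<in> B \<and> x \<otimes> inv y = d}
      = {(x, y). x \<in> A \<and> y \<in> B \<and> y = inv d \<otimes> x}"
    by blast
  also have "\<dots> = (\<lambda>x. (x, inv d \<otimes> x)) ` {x \<in> A. inv d \<otimes> x \<in> B}"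
    by auto
  finally show ?thesis
    unfolding count_diff_mset[OF assms(1,2)] by (simp add: card_image inj_on_def)
qed

lemma diff_mset_eq_group_msetI:
  assumes "finite (carrier G)" "A \<subseteq> carrier G" "B \<subseteq> carrier G"
    and "\<And>d. d \<in> carrier G \<Longrightarrow> count (diff_mset G A B) d = l"
  shows "diff_mset G A B = group_mset l G"
proof (rule multiset_eqI)
  fix d
  have fin: "finite A" "finite B"
    using assms finite_subset by blast+
  show "count (diff_mset G A B) d = count (group_mset l G) d"
  proof (cases "d \<in> carrier G")
    case True
    then show ?thesis using assms by (simp add: group_mset_def)
  next
    case False
    then have "{(x, y). x \<in> A \<and> y \<in> B \<and> x \<otimes> inv y = d} = {}"
      using assms(2,3) by auto
    then show ?thesis
      using False by (simp add: count_diff_mset[OF fin] group_mset_def del: Collect_empty_eq)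
  qed
qed

end

text \<open>The interval splits into \<open>k\<close> blocks of length \<open>b\<close>. A shift by
  \<open>d\<close> permutes the residues modulo \<open>b\<close>, so each block has exactly one
  \<open>y\<close> for every prescribed residue \<open>r\<close> of \<open>y + d\<close>.\<close>

lemma card_residues_interval:
  fixes b k :: nat and d :: int
  assumes "b > 0" "R \<subseteq> {0..<int b}"
  shows "card {y \<in> {0..<int (k * b)}. (y + d) mod int b \<in> R} = k * card R"
proof -
  have "bij_betw (\<lambda>y. (y div int b, (y + d) mod int b))
      {y \<in> {0..<int (k * b)}. (y + d) mod int b \<in> R} ({0..<int k} \<times> R)"
  \<comment> \<open>The inverse map: in block \<open>q\<close>, the element whose shift has residue
    \<open>r\<close> sits at offset \<open>(r - d) mod int b\<close>.\<close>
  proof (rule bij_betw_byWitness[where f' = "\<lambda>(q, r). q * int b + (r - d) mod int b"])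
    have div: "(q * int b + (r - d) mod int b) div int b = q" for q r
      using assms(1) by simp
    have div_less: "y div int b < int k" if "y < int k * int b" for y
    proof -
      have "y div int b * int b < int k * int b"
        using that assms(1) pos_mod_sign[of "int b" y] div_mult_mod_eq[of y "int b"] by linarith
      then show ?thesis using assms(1) by simp
    qed
    have mod: "(q * int b + (r - d) mod int b + d) mod int b = r" if "r \<in> R" for q r
    proof -
      have "(q * int b + (r - d) mod int b + d) mod int b = ((r - d) mod int b + d) mod int b"
        by (simp add: add.assoc)
      also have "\<dots> = r mod int b"
        by (simp add: mod_add_left_eq)
      finally show ?thesis using that assms(2) by auto
    qed
    have range: "0 \<le> q * int b + (r - d) mod int b \<and> q * int b + (r - d) mod int b < int (k * b)"
      if "0 \<le> q" "q < int k" for q r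
    proof -
      \<comment> \<open>As \<open>q + 1 \<le> k\<close>, the whole block \<open>q\<close> ends by
        \<open>k * b\<close>, whatever the offset in it.\<close>
      have "(q + 1) * int b \<le> int k * int b"
        using that by (intro mult_right_mono) auto
      moreover have "0 \<le> (r - d) mod int b" "(r - d) mod int b < int b"
        using assms(1) by auto
      ultimately show ?thesis using that by (auto simp: algebra_simps)
    qed
    show "\<forall>y\<in>{y \<in> {0..<int (k * b)}. (y + d) mod int b \<in> R}.
        (case (y div int b, (y + d) mod int b) of (q, r) \<Rightarrow> q * int b + (r - d) mod int b) = y"
      by (simp add: mod_diff_left_eq)
    show "\<forall>p\<in>{0..<int k} \<times> R.
        ((case p of (q, r) \<Rightarrow> q * int b + (r - d) mod int b) div int b,
         ((case p of (q, r) \<Rightarrow> q * int b + (r - d) mod int b) + d) mod int b) = p"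
      using div mod by auto
    show "(\<lambda>y. (y div int b, (y + d) mod int b)) ` {y \<in> {0..<int (k * b)}. (y + d) mod int b \<in> R}
        \<subseteq> {0..<int k} \<times> R"
      using assms(1) div_less by (auto simp: pos_imp_zdiv_nonneg_iff)
    show "(\<lambda>(q, r). q * int b + (r - d) mod int b) ` ({0..<int k} \<times> R)
        \<subseteq> {y \<in> {0..<int (k * b)}. (y + d) mod int b \<in> R}"
      using mod range by auto
  qed
  then show ?thesis
    by (simp add: bij_betw_same_card card_cartesian_product)
qed

theorem theorem3p7:
  fixes v a b k1 k2 :: nat
  assumes "a \<ge> 1" and "b \<ge> 1" and "v = a * b"
    and "1 \<le> k1" and "k1 \<le> b - 1"
    and "1 \<le> k2" and "k2 \<le> a - 1"
  shows "\<exists>A1 A2. nondisjoint_GPSEDF (integer_mod_group v) v 2 [k1 * a, k2 * b] [A1, A2]"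
proof -
  define G where "G = integer_mod_group v"
  define R where "R = {0..<int k1}"
  \<comment> \<open>The summand 0 gives \<open>A1\<close> the form counted by
    \<open>card_residues_interval\<close> with zero shift and \<open>a\<close> blocks.\<close>
  define A1 where "A1 = {y \<in> {0..<int (a * b)}. (y + 0) mod int b \<in> R}"
  define A2 where "A2 = {0..<int (k2 * b)}"
  have b: "b > 0" and v: "v > 0" and R: "R \<subseteq> {0..<int b}" and cR: "card R = k1"
    using assms by (auto simp: R_def)
  interpret group G
    unfolding G_def by simp
  have carrier: "carrier G = {0..<int v}"
    using v by (simp add: G_def carrier_integer_mod_group)
  \<comment> \<open>This keeps the interval \<open>A2\<close> among the representatives below
    \<open>v\<close>, without wrapping around.\<close>
  have "k2 * b \<le> a * b"
    using assms by (intro mult_right_mono) auto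
  then have sub: "A1 \<subseteq> carrier G" "A2 \<subseteq> carrier G"
    using assms(3) by (auto simp: carrier A1_def A2_def simp del: of_nat_mult)
  have finG: "finite (carrier G)"
    by (simp add: carrier)
  note fin = finG sub[THEN finite_subset, OF finG]
  have translate: "card {y \<in> A2. d \<otimes>\<^bsub>G\<^esub> y \<in> A1} = k1 * k2" if "d \<in> carrier G" for d
  proof -
    have "d \<otimes>\<^bsub>G\<^esub> y \<in> A1 \<longleftrightarrow> (y + d) mod int b \<in> R" for y
    proof -
      \<comment> \<open>Since \<open>b\<close> divides \<open>v\<close>, reduction modulo
        \<open>v\<close> preserves residues modulo \<open>b\<close>.\<close>
      have "(d + y) mod int v mod int b = (y + d) mod int b"
        using assms(3) by (simp add: mod_mod_cancel add.commute)
      then show ?thesis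
        using v assms(3) by (simp add: G_def mult_integer_mod_group A1_def flip: of_nat_mult)
    qed
    then show ?thesis
      using card_residues_interval[OF b R, of k2 d] cR by (simp add: A2_def mult.commute)
  qed
  have "diff_mset G A1 A2 = group_mset (k1 * k2) G"
    using sub fin translate by (intro diff_mset_eq_group_msetI) (auto simp: count_diff_mset_right)
  \<comment> \<open>The count \<open>translate\<close> holds for every group element, so it applies
    to \<open>inv d\<close> as well.\<close>
  moreover have "diff_mset G A2 A1 = group_mset (k1 * k2) G"
    using sub fin translate by (intro diff_mset_eq_group_msetI) (auto simp: count_diff_mset_left)
  moreover have "card A1 = k1 * a" "card A2 = k2 * b"
    using card_residues_interval[OF b R, of a 0] cR
    by (simp_all add: A1_def A2_def mult.commute flip: of_nat_mult)
  moreover have "real (k1 * k2) = real (k1 * a) * real (k2 * b) / real v"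
    "real (k1 * k2) = real (k2 * b) * real (k1 * a) / real v"
    using assms(1-3) by simp_all
  moreover have "order G = v"
    by (simp add: order_def carrier)
  ultimately have "nondisjoint_GPSEDF G v 2 [k1 * a, k2 * b] [A1, A2]"
    using sub finG is_group
    by (auto simp: nondisjoint_GPSEDF_def numeral_2_eq_2 less_Suc_eq simp del: of_nat_mult
        intro!: exI[of _ "k1 * k2"])
  then show ?thesis
    unfolding G_def by blast
qed

end
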